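(* Let $n, m, k$ be integers with $n, k \ge 3$ and $m \ge 2$. Then the metric dimension of the layer Sun graph $LSG(n,m,k)$ is $nm^{k-2} - nm^{k-3}$.
   Context: All graphs are finite, simple and connected; $d(x,y)$ denotes the length of a shortest path between vertices $x$ and $y$. Layer Sun graph: for integers $n,k\ge 3$ and $m\ge 2$, the graph $LSG(n,m,k)$ has vertex set partitioned into layers $V_1\cup V_2\cup\dots\cup V_k$. The layer $V_1=\{1,2,\dots,n\}$ induces the cycle $C_n$. The layer $V_2=\{v_1,\dots,v_n\}$ has $n$ vertices, and each cycle vertex $i$ is adjacent to exactly one vertex of $V_2$, namely $v_i$. For $3\le l\le k$, the layer $V_l$ has $nm^{l-2}$ vertices and is partitioned into $nm^{l-3}$ sets (components) $B^{(l)}_{ij}$, $1\le i\le n$, $1\le j\le m^{l-3}$, each consisting of $m$ pairwise non-adjacent vertices. Each $v_i\in V_2$ is adjacent to all $m$ vertices of $B^{(3)}_{i1}$, and, for $3\le l\le k-1$ and each $i$, the $m^{l-2}$ vertices of $\bigcup_j B^{(l)}_{ij}$ are in bijection with the $m^{l-2}$ components $B^{(l+1)}_{i1},\dots,B^{(l+1)}_{i\,m^{l-2}}$ of $V_{l+1}$, each vertex being adjacent to all $m$ vertices of its corresponding component. There are no other edges. Equivalently, $LSG(n,m,k)$ is obtained from $C_n$ by attaching to each cycle vertex $i$, by an edge to its root $v_i$, a rooted tree in which the root has level $2$, every vertex of level $2,\dots,k-1$ has exactly $m$ children, and the vertices of level $k$ are leaves. The graph has order $2n+\sum_{r=1}^{k-2}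 nm^r$. Metric dimension: a set $W=\{w_1,\dots,w_p\}$ of vertices of a graph $G$ is a resolving set if distinct vertices $v$ of $G$ have distinct vectors $(d(v,w_1),\dots,d(v,w_p))$. The metric dimension $\beta(G)$ is the minimum cardinality of a resolving set of $G$. *)

theory Defs
  imports "Graph_Theory.Graph_Theory" "HOL-Library.FuncSet"
begin

text \<open>
  Finite simple graphs are modelled as \<^locale>\<open>pair_graph\<close>: finite, symmetric, loop-free
  digraphs whose arcs are ordered pairs of vertices, so that an undirected edge is a pair of
  opposite arcs.
\<close>

section \<open>Distance and metric dimension\<close>

text \<open>Only meaningful if there is a path from u to v; the graphs considered here are connected.\<close>

definition gdist :: "'a pair_pre_digraph \<Rightarrow> 'a \<Rightarrow> 'a \<Rightarrow> nat" where
  "gdist G u v = (LEAST r. \<exists>p. pre_digraph.apath (with_proj G) u p v \<and> length p = r)"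

text \<open>
  The vector of distances from v to the landmarks in W is represented as a function on W.
\<close>

definition resolving_set :: "'a pair_pre_digraph \<Rightarrow> 'a set \<Rightarrow> bool" where
  "resolving_set G W \<longleftrightarrow>
     W \<subseteq> pverts G \<and> inj_on (\<lambda>v. \<lambda>w\<in>W. gdist G v w) (pverts G)"

definition metric_dimension :: "'a pair_pre_digraph \<Rightarrow> nat" where
  "metric_dimension G = (LEAST r. \<exists>W. finite W \<and> resolving_set G W \<and> card W = r)"

section \<open>The layer Sun graph\<close>

text \<open>
  \<open>Cyc i\<close> is the i-th cycle vertex (layer 1, indices 0, ..., n - 1 instead of 1, ..., n).
  \<open>Tree i p\<close> is the vertex of the rooted tree attached to \<open>Cyc i\<close> that is reached from the
  root by successively going to the child numbers listed in p; it has level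
  \<open>length p + 2\<close>. Hence \<open>Tree i []\<close> is the root (the vertex called \<open>v\<^sub>i\<close>), and the children
  \<open>Tree i (p @ [c])\<close>, c < m, of \<open>Tree i p\<close> form one component of the next layer.
\<close>

datatype lsg_vertex = Cyc nat | Tree nat "nat list"

definition lsg_verts :: "nat \<Rightarrow> nat \<Rightarrow> nat \<Rightarrow> lsg_vertex set" where
  "lsg_verts n m k =
     {Cyc i |i. i < n} \<union>
     {Tree i p |i p. i < n \<and> set p \<subseteq> {..<m} \<and> length p + 2 \<le> k}"

definition lsg_edges :: "nat \<Rightarrow> nat \<Rightarrow> nat \<Rightarrow> lsg_vertex rel" where
  "lsg_edges n m k =
     {(Cyc i, Cyc (Suc i mod n)) |i. i < n} \<union>
     {(Cyc i, Tree i []) |i. i < n} \<union>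
     {(Tree i p, Tree i (p @ [c])) |i p c.
        i < n \<and> set p \<subseteq> {..<m} \<and> length p + 2 < k \<and> c < m}"

definition LSG :: "nat \<Rightarrow> nat \<Rightarrow> nat \<Rightarrow> lsg_vertex pair_pre_digraph" where
  "LSG n m k = \<lparr> pverts = lsg_verts n m k,
                 parcs = lsg_edges n m k \<union> (lsg_edges n m k)\<inverse> \<rparr>"

section \<open>Sanity checks\<close>

lemma gdist_eq_mu:
  assumes "pair_graph G" and "reachable (with_proj G) u v"
  shows "ereal (real (gdist G u v)) = wf_digraph.\<mu> (with_proj G) (\<lambda>_. 1) u v"
proof -
  interpret pair_graph G by fact
  have cost: "awalk_cost (\<lambda>_. 1) p = real (length p)" for p
    by (induct p) (auto simp: awalk_cost_def)
  obtain p where p: "apath u p v" "\<mu> (\<lambda>_. 1) u v = awalk_cost (\<lambda>_. 1) p"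
    using min_cost_awalk[of u v "\<lambda>_. 1"] assms(2) by auto
  have "length p \<le> length q" if "apath u q v" for q
    using min_cost_le_walk_cost[OF awalkI_apath[OF that], of "\<lambda>_. 1"] p(2) cost by simp
  then have "gdist G u v = length p"
    unfolding gdist_def using p(1) by (intro Least_equality) auto
  with p(2) cost show ?thesis by simp
qed

lemma finite_lsg_verts: "finite (lsg_verts n m k)"
proof -
  have "lsg_verts n m k \<subseteq>
      Cyc ` {..<n} \<union> case_prod Tree ` ({..<n} \<times> {p. set p \<subseteq> {..<m} \<and> length p \<le> k})"
    by (auto simp: lsg_verts_def image_iff)
  then show ?thesis
    by (rule finite_subset) (auto intro!: finite_lists_length_le)
qed

lemma lsg_edges_subset: "k \<ge> 2 \<Longrightarrow> lsg_edges n m k \<subseteq> lsg_verts n m k \<times> lsg_verts n m k"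
  by (auto simp: lsg_edges_def lsg_verts_def)

lemma pair_graph_LSG:
  assumes "n \<ge> 3" "k \<ge> 3"
  shows "pair_graph (LSG n m k)"
proof
  fix e assume e: "e \<in> parcs (LSG n m k)"
  then show "fst e \<in> pverts (LSG n m k)" "snd e \<in> pverts (LSG n m k)"
    using lsg_edges_subset[of k n m] assms by (auto simp: LSG_def)
  have "Suc i mod n \<noteq> i" if "i < n" for i
    using that assms by (cases "Suc i = n") auto
  then show "fst e \<noteq> snd e"
    using e by (auto simp: LSG_def lsg_edges_def) metis+
next
  show fin: "finite (pverts (LSG n m k))"
    by (simp add: LSG_def finite_lsg_verts)
  have "finite (lsg_edges n m k)"
    using lsg_edges_subset[of k n m] assms finite_lsg_verts[of n m k]
    by (auto intro: finite_subset)
  then show "finite (parcs (LSG n m k))"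
    by (simp add: LSG_def)
  show "symmetric (with_proj (LSG n m k))"
    by (auto simp: symmetric_def LSG_def intro: symI)
qed

lemma strongly_connected_LSG:
  assumes "n \<ge> 3" "k \<ge> 3"
  shows "strongly_connected (with_proj (LSG n m k))"
proof -
  interpret pair_graph "LSG n m k" by (rule pair_graph_LSG[OF assms])
  let ?G = "with_proj (LSG n m k)"
  have cyc: "reachable ?G (Cyc 0) (Cyc i)" if "i < n" for i
    using that
  proof (induct i)
    case 0
    then have "Cyc 0 \<in> pverts (LSG n m k)" by (auto simp: LSG_def lsg_verts_def)
    then show ?case by (rule reachable_refl)
  next
    case (Suc i)
    have "(Cyc i, Cyc (Suc i mod n)) \<in> lsg_edges n m k"
      using Suc.prems unfolding lsg_edges_def by auto
    then have "(Cyc i, Cyc (Suc i)) \<in> parcs (LSG n m k)"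
      using Suc.prems by (simp add: LSG_def)
    then show ?case
      using Suc reachable_adj_trans[of "Cyc 0" "Cyc i" "Cyc (Suc i)"] by simp
  qed
  have tree: "reachable ?G (Cyc 0) (Tree i p)"
    if "i < n" "set p \<subseteq> {..<m}" "length p + 2 \<le> k" for i p
    using that
  proof (induct p rule: rev_induct)
    case Nil
    then have "(Cyc i, Tree i []) \<in> parcs (LSG n m k)"
      by (auto simp: LSG_def lsg_edges_def)
    then show ?case
      using cyc[of i] Nil reachable_adj_trans[of "Cyc 0" "Cyc i" "Tree i []"] by simp
  next
    case (snoc c p)
    then have "(Tree i p, Tree i (p @ [c])) \<in> parcs (LSG n m k)"
      by (auto simp: LSG_def lsg_edges_def)
    then show ?case
      using snoc reachable_adj_trans[of "Cyc 0" "Tree i p" "Tree i (p @ [c])"] by simp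
  qed
  have *: "reachable ?G (Cyc 0) v" if "v \<in> pverts (LSG n m k)" for v
    using that cyc tree by (auto simp: LSG_def lsg_verts_def)
  show ?thesis
  proof (rule strongly_connectedI)
    have "Cyc 0 \<in> pverts (LSG n m k)"
      using assms by (auto simp: LSG_def lsg_verts_def)
    then show "verts ?G \<noteq> {}" by auto
  next
    fix u v assume "u \<in> verts ?G" "v \<in> verts ?G"
    then show "reachable ?G u v"
      using * symmetric_reachable[OF pair_sym_arcs] reachable_trans
      by (metis with_proj_simps(1))
  qed
qed

lemma card_LSG:
  assumes "k \<ge> 3"
  shows "card (pverts (LSG n m k)) = 2 * n + (\<Sum>r = 1..k - 2. n * m ^ r)"
proof -
  let ?L = "{p. set p \<subseteq> {..<m} \<and> length p \<le> k - 2}"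
  have eq: "pverts (LSG n m k) = Cyc ` {..<n} \<union> case_prod Tree ` ({..<n} \<times> ?L)"
    using assms by (auto simp: LSG_def lsg_verts_def image_iff)
  have finL: "finite ?L" by (rule finite_lists_length_le) simp
  have "card (pverts (LSG n m k)) = card (Cyc ` {..<n}) + card (case_prod Tree ` ({..<n} \<times> ?L))"
    unfolding eq by (rule card_Un_disjoint) (use finL in auto)
  also have "card (Cyc ` {..<n}) = n"
    by (simp add: card_image inj_on_def)
  also have "card (case_prod Tree ` ({..<n} \<times> ?L)) = n * card ?L"
    by (subst card_image) (auto simp: inj_on_def card_cartesian_product)
  also have "card ?L = (\<Sum>r\<le>k - 2. m ^ r)"
    by (subst card_lists_length_le) auto
  also have "\<dots> = 1 + (\<Sum>r = 1..k - 2. m ^ r)"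
    by (simp add: atMost_atLeast0 sum.atLeast_Suc_atMost)
  finally show ?thesis by (simp add: sum_distrib_left algebra_simps)
qed

lemma metric_dimension_attained:
  assumes "pair_graph G" "strongly_connected (with_proj G)"
  shows "\<exists>W. finite W \<and> resolving_set G W \<and> card W = metric_dimension G"
proof -
  interpret pair_graph G by fact
  have path: "\<exists>p. apath u p v \<and> length p = gdist G u v" if "u \<in> pverts G" "v \<in> pverts G" for u v
  proof -
    have "reachable (with_proj G) u v"
      using assms(2) that by (auto simp: strongly_connected_def)
    then have "\<exists>r p. apath u p v \<and> length p = r"
      by (auto simp: reachable_apath)
    then show ?thesis unfolding gdist_def by (rule LeastI_ex)
  qed
  have self: "gdist G v v = 0" if "v \<in> pverts G" for v
    unfolding gdist_def using that by (intro Least_equality) (auto simp: apath_Nil_iff)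
  have "resolving_set G (pverts G)"
    unfolding resolving_set_def
  proof (intro conjI inj_onI)
    fix u v
    assume u: "u \<in> pverts G" and v: "v \<in> pverts G"
      and eq: "(\<lambda>w\<in>pverts G. gdist G u w) = (\<lambda>w\<in>pverts G. gdist G v w)"
    have "gdist G u v = 0"
      using fun_cong[OF eq, of v] v self[OF v] by simp
    with path[OF u v] show "u = v" by (auto simp: apath_Nil_iff)
  qed simp
  then have "\<exists>r W. finite W \<and> resolving_set G W \<and> card W = r"
    using pair_finite_verts by blast
  then show ?thesis unfolding metric_dimension_def by (rule LeastI_ex)
qed

end

theory Submission
  imports Defs
begin

text \<open>
  All pairs of leaves with a common parent are twins: a landmark other than the two leaves
  themselves does not separate them. A resolving set therefore misses at most one leaf below each
  of the \<open>n * m ^ (k - 3)\<close> parents, which is the lower bound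
  (\<open>card_resolving_set_LSG\<close>).

  Conversely, the set of all leaves except the child number 0 of each parent is resolving
  (\<open>resolving_set_leaf_landmarks\<close>). As \<open>m \<ge> 2\<close>, there is a landmark below every vertex of level
  \<open>k - 1\<close>, hence in every branch, where a branch is a cycle vertex together with its tree. Let two
  vertices have equal distances to all landmarks.
  If they lay in different branches, a landmark in the branch of the first one would be reached
  from the second one only by climbing down to the cycle and walking along it, so the second
  vertex would be strictly closer to the cycle than the first one; by symmetry this is absurd. In
  a common branch, a landmark of any other branch shows that they have the same level. Two
  distinct inner vertices of the same level are separated by a landmark below one of them; two
  distinct leaves outside the set have distinct parents and are separated by a sibling of one of
  them.

  These arguments need the distances to a tree vertex explicitly. Instead of comparing paths, the
  formula is verified locally, by \<open>gdist_eqI\<close>.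
\<close>

section \<open>Distances in a graph\<close>

context pair_graph
begin

lemma gdist_le_length_awalk:
  assumes "awalk u p v"
  shows "gdist G u v \<le> length p"
proof -
  let ?q = "awalk_to_apath p"
  have q: "apath u ?q v"
    by (rule apath_awalk_to_apath[OF assms])
  then have "distinct ?q"
    using distinct_verts_imp_distinct by (auto simp: apath_def)
  then have "length ?q = card (set ?q)"
    by (simp add: distinct_card)
  also have "\<dots> \<le> card (set p)"
    by (intro card_mono awalk_to_apath_subset[OF assms]) simp
  also have "\<dots> \<le> length p"
    by (rule card_length)
  finally show ?thesis
    unfolding gdist_def using q by (intro order_trans[OF Least_le]) auto
qed

lemma shortest_awalk_exists:
  assumes "awalk u p v"
  obtains q where "awalk u q v" "length q = gdist G u v"
proof -
  have "\<exists>r q. apath u q v \<and> length q = r"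
    using apath_awalk_to_apath[OF assms] by blast
  then have "\<exists>q. apath u q v \<and> length q = gdist G u v"
    unfolding gdist_def by (rule LeastI_ex)
  then show thesis
    using that awalkI_apath by blast
qed

text \<open>
  A local characterisation of the distance to a fixed vertex: along a walk to \<open>w\<close>, a function as
  below drops by at most 1 per arc, so no walk is shorter than its initial value; always moving
  to a neighbour where it is smaller gives a walk of exactly that length.
\<close>

lemma gdist_eqI:
  fixes f :: "'a \<Rightarrow> nat"
  assumes zero: "f w = 0"
    and step: "\<And>x y. (x, y) \<in> parcs G \<Longrightarrow> f x \<le> Suc (f y)"
    and descent: "\<And>x. x \<in> pverts G \<Longrightarrow> x \<noteq> w \<Longrightarrow> \<exists>y. (x, y) \<in> parcs G \<and> f y < f x"
    and x: "x \<in> pverts G"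
  shows "gdist G x w = f x"
proof -
  have lower: "f x \<le> length p" if "awalk x p w" for x p
    using that
  proof (induction p arbitrary: x)
    case Nil
    then show ?case by (simp add: awalk_Nil_iff zero)
  next
    case (Cons e p)
    then have "(x, snd e) \<in> parcs G" "awalk (snd e) p w"
      by (auto simp: awalk_Cons_iff)
    with Cons.IH step[of x "snd e"] show ?case by fastforce
  qed
  have "\<exists>p. awalk x p w \<and> length p = f x"
    using x
  proof (induction "f x" arbitrary: x rule: less_induct)
    case less
    show ?case
    proof (cases "x = w")
      case True
      with less.prems zero show ?thesis
        by (intro exI[of _ "[]"]) (simp add: awalk_Nil_iff)
    next
      case False
      then obtain y where y: "(x, y) \<in> parcs G" "f y < f x"
        using descent less.prems by blast
      then have "y \<in> pverts G"
        using in_arcsD2 by simp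
      then obtain p where "awalk y p w" "length p = f y"
        using less.hyps y by blast
      with y step[OF y(1)] less.prems show ?thesis
        by (intro exI[of _ "(x, y) # p"]) (auto simp: awalk_Cons_iff)
    qed
  qed
  then obtain p where p: "awalk x p w" "length p = f x" by blast
  obtain q where "awalk x q w" "length q = gdist G x w"
    using shortest_awalk_exists[OF p(1)] .
  with lower[of x q] gdist_le_length_awalk[OF p(1)] p(2) show ?thesis
    by simp
qed

text \<open>Twins: a walk leaving \<open>u\<close> becomes a walk leaving \<open>v\<close> when its first arc is exchanged.\<close>

lemma gdist_twins_le:
  assumes twins: "\<And>y. (u, y) \<in> parcs G \<Longrightarrow> (v, y) \<in> parcs G"
    and p: "awalk u p w" and "w \<noteq> u"
  shows "gdist G v w \<le> gdist G u w"
proof -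
  obtain q where q: "awalk u q w" "length q = gdist G u w"
    using shortest_awalk_exists[OF p] .
  with \<open>w \<noteq> u\<close> obtain e q' where [simp]: "q = e # q'"
    by (cases q) (auto simp: awalk_Nil_iff)
  have "(u, snd e) \<in> parcs G" "awalk (snd e) q' w"
    using q(1) by (auto simp: awalk_Cons_iff)
  moreover from this have "(v, snd e) \<in> parcs G"
    using twins by blast
  ultimately have "awalk v ((v, snd e) # q') w"
    using in_arcsD1 by (auto simp: awalk_Cons_iff)
  then have "gdist G v w \<le> length ((v, snd e) # q')"
    by (rule gdist_le_length_awalk)
  with q(2) show ?thesis by simp
qed

lemma gdist_twins:
  assumes conn: "strongly_connected G"
    and twins: "\<And>y. (u, y) \<in> parcs G \<longleftrightarrow> (v, y) \<in> parcs G"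
    and verts: "u \<in> pverts G" "v \<in> pverts G" "w \<in> pverts G" and "w \<noteq> u" "w \<noteq> v"
  shows "gdist G u w = gdist G v w"
proof -
  have "\<exists>p. awalk x p w" if "x \<in> pverts G" for x
    using conn that verts(3) by (auto simp: strongly_connected_def reachable_awalk)
  then obtain p q where "awalk u p w" "awalk v q w"
    using verts by blast
  with gdist_twins_le[of u v p w] gdist_twins_le[of v u q w] twins assms(6,7) show ?thesis
    by (simp add: le_antisym)
qed

end

section \<open>Distances in a tree and in a cycle\<close>

text \<open>
  In a rooted tree whose vertices are addressed by the lists of child numbers leading to them,
  this is the distance of two vertices: the common prefix of the addresses is removed, since the
  path between them turns round at their last common ancestor.
\<close>

fun tree_dist :: "'a list \<Rightarrow> 'a list \<Rightarrow> nat" where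
  "tree_dist (x # p) (y # q) = (if x = y then tree_dist p q else length p + length q + 2)"
| "tree_dist p q = length p + length q"

lemma tree_dist_Nil [simp]: "tree_dist [] q = length q" "tree_dist p [] = length p"
  by (cases q; simp) (cases p; simp)

lemma tree_dist_append_same [simp]: "tree_dist (s @ p) (s @ q) = tree_dist p q"
  by (induction s) auto

lemma tree_dist_self [simp]: "tree_dist p p = 0"
  by (induction p) auto

lemma tree_dist_pos: "p \<noteq> q \<Longrightarrow> 0 < tree_dist p q"
  by (induction p q rule: tree_dist.induct) (auto split: if_splits)

lemma tree_dist_le: "tree_dist p q \<le> length p + length q"
  by (induction p q rule: tree_dist.induct) auto

lemma tree_dist_snoc:
  "tree_dist (p @ [c]) q = Suc (tree_dist p q) \<or> tree_dist p q = Suc (tree_dist (p @ [c]) q)"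
proof (induction p q rule: tree_dist.induct)
  case ("2_1" q)
  then show ?case by (cases q) auto
qed auto

text \<open>
  A path from a child of \<open>p\<close> to a vertex that is not below this child has to pass through \<open>p\<close>.
\<close>

lemma tree_dist_snoc_not_prefix:
  "(\<nexists>r. q = p @ [c] @ r) \<Longrightarrow> tree_dist (p @ [c]) q = Suc (tree_dist p q)"
proof (induction p q rule: tree_dist.induct)
  case ("2_1" q)
  then show ?case by (cases q) auto
qed auto

text \<open>Addresses that have already diverged keep their last common ancestor when extended.\<close>

lemma tree_dist_extend_distinct:
  "p \<noteq> q \<Longrightarrow> length p = length q \<Longrightarrow>
    tree_dist (p @ r) (q @ s) = tree_dist p q + length r + length s"
  by (induction p q rule: tree_dist.induct) auto

text \<open>
  The subtractions are truncated, so \<open>(i - j) + (j - i)\<close> is the absolute difference; the minimum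
  is over the two ways round the cycle.
\<close>

definition cyc_dist :: "nat \<Rightarrow> nat \<Rightarrow> nat \<Rightarrow> nat" where
  "cyc_dist n i j = min ((i - j) + (j - i)) (n - ((i - j) + (j - i)))"

lemma cyc_dist_self [simp]: "cyc_dist n i i = 0"
  by (simp add: cyc_dist_def)

lemma cyc_dist_commute: "cyc_dist n i j = cyc_dist n j i"
  by (simp add: cyc_dist_def add.commute)

lemma cyc_dist_pos: "i < n \<Longrightarrow> j < n \<Longrightarrow> i \<noteq> j \<Longrightarrow> 0 < cyc_dist n i j"
  by (auto simp: cyc_dist_def)

lemma Suc_mod_cases:
  assumes "i < n"
  obtains "Suc i < n" "Suc i mod n = Suc i" | "n = Suc i" "Suc i mod n = 0"
  using assms by (cases "Suc i = n") auto

lemma cyc_dist_step: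
  assumes "i < n" "j < n"
  shows "cyc_dist n i j \<le> Suc (cyc_dist n (Suc i mod n) j) \<and>
         cyc_dist n (Suc i mod n) j \<le> Suc (cyc_dist n i j)"
  using assms(1)
proof (rule Suc_mod_cases)
  assume "Suc i < n" "Suc i mod n = Suc i"
  with assms show ?thesis
    by (cases "i < j") (auto simp: cyc_dist_def min_def)
qed (use assms in \<open>auto simp: cyc_dist_def min_def\<close>)

lemma cyc_dist_descent:
  assumes "i < n" "j < n" "i \<noteq> j"
  obtains "cyc_dist n (Suc i mod n) j < cyc_dist n i j"
  | i' where "i' < n" "i = Suc i' mod n" "cyc_dist n i' j < cyc_dist n i j"
proof (cases "cyc_dist n (Suc i mod n) j < cyc_dist n i j")
  case False
  define i' where "i' = (if i = 0 then n - 1 else i - 1)"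
  have "i' < n" "i = Suc i' mod n"
    using assms by (auto simp: i'_def)
  moreover have "cyc_dist n i' j < cyc_dist n i j"
    using \<open>i < n\<close>
  proof (rule Suc_mod_cases)
    assume "Suc i < n" "Suc i mod n = Suc i"
    with assms False show ?thesis
      by (cases "i < j"; cases "i = 0")
        (auto simp: i'_def cyc_dist_def min_def split: if_splits; linarith)+
  next
    assume "n = Suc i" "Suc i mod n = 0"
    with assms False show ?thesis
      by (cases "i = 0") (auto simp: i'_def cyc_dist_def min_def split: if_splits)
  qed
  ultimately show thesis by (rule that(2))
qed (rule that(1))

section \<open>Distances in the layer Sun graph\<close>

text \<open>
  This turns out to be the distance of a vertex to \<open>Tree j q\<close>: the trees are connected only
  through the cycle, so a path from another tree has to go down to its cycle vertex, along the
  cycle to \<open>Cyc j\<close>, and up again. The edges between a cycle vertex and the root of its tree account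
  for the summands 1 and 2.
\<close>

fun lsg_dist :: "nat \<Rightarrow> nat \<Rightarrow> nat list \<Rightarrow> lsg_vertex \<Rightarrow> nat" where
  "lsg_dist n j q (Cyc i) = cyc_dist n i j + length q + 1"
| "lsg_dist n j q (Tree i p) =
     (if i = j then tree_dist p q else cyc_dist n i j + length p + length q + 2)"

lemma lsg_dist_step:
  assumes "(x, y) \<in> lsg_edges n m k" "j < n"
  shows "lsg_dist n j q x \<le> Suc (lsg_dist n j q y) \<and>
         lsg_dist n j q y \<le> Suc (lsg_dist n j q x)"
proof -
  consider i where "i < n" "x = Cyc i" "y = Cyc (Suc i mod n)"
    | i where "i < n" "x = Cyc i" "y = Tree i []"
    | i p c where "x = Tree i p" "y = Tree i (p @ [c])"
    using assms(1) by (auto simp: lsg_edges_def)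
  then show ?thesis
  proof cases
    case 1
    with cyc_dist_step assms(2) show ?thesis by simp
  next
    case 3
    with tree_dist_snoc[of p c q] show ?thesis by auto
  qed simp
qed

text \<open>
  The next vertex on the way to \<open>Tree j q\<close>: the child towards \<open>q\<close> if \<open>Tree j q\<close> lies below \<open>x\<close>,
  the parent of any other tree vertex, and a neighbour on the shorter way round for a cycle vertex
  other than \<open>Cyc j\<close>.
\<close>

lemma lsg_dist_descent:
  assumes "x \<in> lsg_verts n m k" "x \<noteq> Tree j q"
    and "k \<ge> 3" and q: "j < n" "set q \<subseteq> {..<m}" "length q + 2 \<le> k"
  shows "\<exists>y. (x, y) \<in> parcs (LSG n m k) \<and> lsg_dist n j q y < lsg_dist n j q x"
proof (cases x)
  case (Cyc i)
  then have "i < n"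
    using assms by (auto simp: lsg_verts_def)
  show ?thesis
  proof (cases "i = j")
    case True
    have "(Cyc i, Tree i []) \<in> lsg_edges n m k"
      using \<open>i < n\<close> by (auto simp: lsg_edges_def)
    with True Cyc show ?thesis
      by (intro exI[of _ "Tree i []"]) (simp add: LSG_def)
  next
    case False
    from \<open>i < n\<close> \<open>j < n\<close> False show ?thesis
    proof (cases rule: cyc_dist_descent)
      case 1
      moreover have "(Cyc i, Cyc (Suc i mod n)) \<in> lsg_edges n m k"
        using \<open>i < n\<close> by (auto simp: lsg_edges_def)
      ultimately show ?thesis
        using Cyc by (intro exI[of _ "Cyc (Suc i mod n)"]) (simp add: LSG_def)
    next
      case (2 i')
      then have "(Cyc i', Cyc i) \<in> lsg_edges n m k"
        by (auto simp: lsg_edges_def)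
      with 2 Cyc show ?thesis
        by (intro exI[of _ "Cyc i'"]) (simp add: LSG_def)
    qed
  qed
next
  case (Tree i p)
  then have p: "i < n" "set p \<subseteq> {..<m}" "length p + 2 \<le> k"
    using assms by (auto simp: lsg_verts_def)
  show ?thesis
  proof (cases "i = j \<and> (\<exists>c r. q = p @ c # r)")
    case True
    then obtain c r where r: "q = p @ c # r" by blast
    then have "(Tree i p, Tree i (p @ [c])) \<in> lsg_edges n m k"
      using p q by (auto simp: lsg_edges_def)
    moreover have "tree_dist (p @ [c]) q = length r" "tree_dist p q = Suc (length r)"
      using tree_dist_append_same[of "p @ [c]" "[]" r] tree_dist_append_same[of p "[]" "c # r"]
      by (simp_all add: r)
    ultimately show ?thesis
      using True Tree by (intro exI[of _ "Tree i (p @ [c])"]) (simp add: LSG_def)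
  next
    case False
    show ?thesis
    proof (cases p rule: rev_cases)
      case Nil
      have "(Cyc i, Tree i []) \<in> lsg_edges n m k"
        using p by (auto simp: lsg_edges_def)
      moreover have "i \<noteq> j"
        using False Nil Tree assms(2) by (cases q) auto
      ultimately show ?thesis
        using Tree Nil by (intro exI[of _ "Cyc i"]) (simp add: LSG_def)
    next
      case (snoc p' c)
      have "(Tree i p', Tree i p) \<in> lsg_edges n m k"
        using p snoc by (auto simp: lsg_edges_def)
      moreover have "tree_dist p q = Suc (tree_dist p' q)" if "i = j"
        unfolding snoc
      proof (rule tree_dist_snoc_not_prefix, rule notI)
        assume "\<exists>r. q = p' @ [c] @ r"
        then obtain r where "q = p @ r"
          using snoc by auto
        with False that Tree assms(2) show False
          by (cases r) auto
      qed
      ultimately show ?thesis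
        using Tree snoc by (intro exI[of _ "Tree i p'"]) (simp add: LSG_def)
    qed
  qed
qed

lemma gdist_LSG:
  assumes "n \<ge> 3" "k \<ge> 3" and x: "x \<in> lsg_verts n m k"
    and w: "Tree j q \<in> lsg_verts n m k"
  shows "gdist (LSG n m k) x (Tree j q) = lsg_dist n j q x"
proof -
  interpret pair_graph "LSG n m k"
    using assms by (intro pair_graph_LSG)
  have q: "j < n" "set q \<subseteq> {..<m}" "length q + 2 \<le> k"
    using w by (auto simp: lsg_verts_def)
  show ?thesis
  proof (rule gdist_eqI)
    fix x y assume "(x, y) \<in> parcs (LSG n m k)"
    then show "lsg_dist n j q x \<le> Suc (lsg_dist n j q y)"
      using lsg_dist_step q(1) by (auto simp: LSG_def)
  next
    fix x assume "x \<in> pverts (LSG n m k)" "x \<noteq> Tree j q"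
    then show "\<exists>y. (x, y) \<in> parcs (LSG n m k) \<and> lsg_dist n j q y < lsg_dist n j q x"
      using lsg_dist_descent q \<open>k \<ge> 3\<close> by (simp add: LSG_def)
  qed (use x in \<open>simp_all add: LSG_def\<close>)
qed

fun branch :: "lsg_vertex \<Rightarrow> nat" where
  "branch (Cyc i) = i"
| "branch (Tree i p) = i"

fun height :: "lsg_vertex \<Rightarrow> nat" where
  "height (Cyc i) = 0"
| "height (Tree i p) = Suc (length p)"

lemma branch_less: "x \<in> lsg_verts n m k \<Longrightarrow> branch x < n"
  by (auto simp: lsg_verts_def)

lemma lsg_dist_other_branch:
  "branch x \<noteq> j \<Longrightarrow> lsg_dist n j q x = cyc_dist n (branch x) j + height x + length q + 1"
  by (cases x) auto

text \<open>The walk through the cycle vertex of the branch has the length on the right.\<close>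

lemma lsg_dist_same_branch:
  "branch x = j \<Longrightarrow> lsg_dist n j q x \<le> height x + length q + 1"
  by (cases x) (auto intro!: le_SucI tree_dist_le)

section \<open>Leaves and their parents\<close>

text \<open>Leaves are represented by the pairs of a parent and a child number.\<close>

definition leaf_parents :: "nat \<Rightarrow> nat \<Rightarrow> nat \<Rightarrow> (nat \<times> nat list) set" where
  "leaf_parents n m k = {..<n} \<times> {p. set p \<subseteq> {..<m} \<and> length p = k - 3}"

fun leaf :: "(nat \<times> nat list) \<times> nat \<Rightarrow> lsg_vertex" where
  "leaf ((i, p), c) = Tree i (p @ [c])"

lemma inj_leaf: "inj leaf"
  by (auto intro!: injI elim!: leaf.elims)

lemma finite_leaf_parents: "finite (leaf_parents n m k)"
  by (simp add: leaf_parents_def finite_lists_length_eq)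

lemma card_leaf_parents: "card (leaf_parents n m k) = n * m ^ (k - 3)"
  by (simp add: leaf_parents_def card_cartesian_product card_lists_length_eq)

lemma leaf_in_verts:
  "k \<ge> 3 \<Longrightarrow> P \<in> leaf_parents n m k \<Longrightarrow> c < m \<Longrightarrow> leaf (P, c) \<in> lsg_verts n m k"
  by (auto simp: leaf_parents_def lsg_verts_def)

lemma leaf_arcs:
  assumes "k \<ge> 3" "(i, p) \<in> leaf_parents n m k" "c < m"
  shows "(leaf ((i, p), c), y) \<in> parcs (LSG n m k) \<longleftrightarrow> y = Tree i p"
  using assms by (auto simp: LSG_def lsg_edges_def leaf_parents_def)

section \<open>The lower bound\<close>

text \<open>Leaves with the same parent are twins, so two of them outside \<open>W\<close> are not separated by \<open>W\<close>.\<close>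

lemma resolving_set_omits_one_child:
  assumes "n \<ge> 3" "k \<ge> 3" and W: "resolving_set (LSG n m k) W"
    and P: "P \<in> leaf_parents n m k" and "c < m" "d < m"
    and notin: "leaf (P, c) \<notin> W" "leaf (P, d) \<notin> W"
  shows "c = d"
proof -
  interpret pair_graph "LSG n m k"
    using assms by (intro pair_graph_LSG)
  have W': "W \<subseteq> pverts (LSG n m k)"
    "inj_on (\<lambda>v. \<lambda>w\<in>W. gdist (LSG n m k) v w) (pverts (LSG n m k))"
    using W by (auto simp: resolving_set_def)
  have verts: "leaf (P, c) \<in> pverts (LSG n m k)" "leaf (P, d) \<in> pverts (LSG n m k)"
    using leaf_in_verts assms by (simp_all add: LSG_def)
  have "gdist (LSG n m k) (leaf (P, c)) w = gdist (LSG n m k) (leaf (P, d)) w" if "w \<in> W" for w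
  proof (rule gdist_twins[OF strongly_connected_LSG[OF assms(1,2)]])
    show "(leaf (P, c), y) \<in> parcs (LSG n m k) \<longleftrightarrow> (leaf (P, d), y) \<in> parcs (LSG n m k)" for y
      using leaf_arcs assms by (cases P) metis
  qed (use that verts W'(1) notin in auto)
  then have "leaf (P, c) = leaf (P, d)"
    by (intro inj_onD[OF W'(2) _ verts]) (simp add: restrict_def fun_eq_iff)
  with inj_leaf show ?thesis
    by (simp add: inj_eq)
qed

text \<open>Mapping the omitted leaves to their parents is injective, so few leaves are omitted.\<close>

lemma card_resolving_set_LSG:
  assumes "n \<ge> 3" "k \<ge> 3" "resolving_set (LSG n m k) W" "finite W"
  shows "n * m ^ (k - 3) * m - n * m ^ (k - 3) \<le> card W"
proof -
  let ?P = "leaf_parents n m k"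
  let ?L = "?P \<times> {..<m}"
  let ?M = "{x \<in> ?L. leaf x \<notin> W}"
  have fin: "finite ?L"
    by (simp add: finite_leaf_parents)
  have "inj_on fst ?M"
  proof (rule inj_onI)
    fix x y assume "x \<in> ?M" "y \<in> ?M" "fst x = fst y"
    then show "x = y"
      using resolving_set_omits_one_child[OF assms(1-3), of "fst x" "snd x" "snd y"]
      by (cases x, cases y) auto
  qed
  then have M: "card ?M \<le> card ?P"
    by (rule card_inj_on_le) (auto simp: finite_leaf_parents)
  have "card ?L - card ?M = card (?L - ?M)"
    by (rule card_Diff_subset[symmetric]) (auto intro: finite_subset[OF _ fin])
  also have "\<dots> = card (leaf ` (?L - ?M))"
    using inj_leaf by (simp add: card_image inj_on_subset)
  also have "\<dots> \<le> card W"
    using assms(4) by (intro card_mono) auto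
  finally show ?thesis
    using M by (simp add: card_cartesian_product card_leaf_parents)
qed

section \<open>A resolving set\<close>

definition leaf_landmarks :: "nat \<Rightarrow> nat \<Rightarrow> nat \<Rightarrow> lsg_vertex set" where
  "leaf_landmarks n m k = leaf ` (leaf_parents n m k \<times> {1..<m})"

lemma card_leaf_landmarks: "card (leaf_landmarks n m k) = n * m ^ (k - 3) * (m - 1)"
  using inj_leaf
  by (simp add: leaf_landmarks_def card_image inj_on_subset card_cartesian_product card_leaf_parents)

text \<open>Padding with zeros reaches level \<open>k - 1\<close>; child number 1 is then a landmark.\<close>

lemma landmark_below:
  assumes "m \<ge> 2" "i < n" "set p \<subseteq> {..<m}" "length p + 3 \<le> k"
  obtains r where "Tree i (p @ r) \<in> leaf_landmarks n m k"
proof -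
  define s where "s = p @ replicate (k - 3 - length p) 0"
  have "(i, s) \<in> leaf_parents n m k"
    using assms by (auto simp: leaf_parents_def s_def)
  then have "leaf ((i, s), 1) \<in> leaf_landmarks n m k"
    unfolding leaf_landmarks_def using assms by (intro imageI SigmaI) auto
  with that show thesis by (simp add: s_def)
qed

lemma nonlandmark_leaf:
  assumes "Tree i p \<in> lsg_verts n m k" "Tree i p \<notin> leaf_landmarks n m k"
    and "length p = k - 2" "k \<ge> 3"
  obtains p' where "p = p' @ [0]" "(i, p') \<in> leaf_parents n m k"
proof (cases p rule: rev_cases)
  case Nil
  with assms show thesis by simp
next
  case (snoc p' c)
  with assms have P: "(i, p') \<in> leaf_parents n m k" "c < m"
    by (auto simp: lsg_verts_def leaf_parents_def)
  have "c = 0"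
  proof (rule ccontr)
    assume "c \<noteq> 0"
    with P have "leaf ((i, p'), c) \<in> leaf_landmarks n m k"
      unfolding leaf_landmarks_def by (intro imageI SigmaI) auto
    with snoc assms(2) show False by simp
  qed
  with that P snoc show thesis by simp
qed

text \<open>
  Two vertices with equal distances to all landmarks are first shown to agree in branch, then in
  height; what remains is to separate two vertices \<open>p \<noteq> q\<close> of equal height in one tree. A landmark
  below \<open>p\<close> does this, since \<open>q\<close> first has to reach \<open>p\<close>; leaves have no landmark below them, and
  the argument is applied to their parents instead.
\<close>

lemma resolving_set_leaf_landmarks:
  assumes "n \<ge> 3" "k \<ge> 3" "m \<ge> 2"
  shows "resolving_set (LSG n m k) (leaf_landmarks n m k)"
  unfolding resolving_set_def
proof
  let ?W = "leaf_landmarks n m k" and ?V = "lsg_verts n m k"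
  have "?W \<subseteq> ?V"
    unfolding leaf_landmarks_def using leaf_in_verts \<open>k \<ge> 3\<close> by (auto simp del: leaf.simps)
  then show "?W \<subseteq> pverts (LSG n m k)"
    by (simp add: LSG_def)
  have "u = v"
    if u: "u \<in> ?V" and v: "v \<in> ?V"
      and eq: "(\<lambda>w\<in>?W. gdist (LSG n m k) u w) = (\<lambda>w\<in>?W. gdist (LSG n m k) v w)" for u v
  proof -
    have dist: "lsg_dist n j q u = lsg_dist n j q v" if "Tree j q \<in> ?W" for j q
      using fun_cong[OF eq, of "Tree j q"] that \<open>?W \<subseteq> ?V\<close> u v gdist_LSG[OF assms(1,2)]
      by (simp add: subset_iff)
    have lm: "\<exists>q. Tree i q \<in> ?W" if "i < n" for i
      by (rule landmark_below[of m i n "[]" k]) (use assms that in auto)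
    \<comment> \<open>Equal distances to the landmarks of both branches would put each of \<open>u\<close> and \<open>v\<close> below the other.\<close>
    have branch: "branch u = branch v"
    proof (rule ccontr)
      assume ne: "branch u \<noteq> branch v"
      obtain q r where q: "Tree (branch u) q \<in> ?W" and r: "Tree (branch v) r \<in> ?W"
        using lm[OF branch_less[OF u]] lm[OF branch_less[OF v]] by blast
      have "cyc_dist n (branch u) (branch v) > 0"
        using ne branch_less[OF u] branch_less[OF v] by (intro cyc_dist_pos)
      moreover have "cyc_dist n (branch v) (branch u) + height v \<le> height u"
        using dist[OF q] ne lsg_dist_same_branch[of u "branch u" n q]
          lsg_dist_other_branch[of v "branch u" n q] by simp
      moreover have "cyc_dist n (branch u) (branch v) + height u \<le> height v"
        using dist[OF r] ne lsg_dist_same_branch[of v "branch v" n r]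
          lsg_dist_other_branch[of u "branch v" n r] by simp
      ultimately show False
        by (simp add: cyc_dist_commute)
    qed
    \<comment> \<open>Seen from another branch, vertices of one branch differ only in their heights.\<close>
    have height: "height u = height v"
    proof -
      define j where "j = (if branch u = 0 then 1 else 0 :: nat)"
      have j: "j < n" "j \<noteq> branch u"
        using assms by (auto simp: j_def)
      then obtain q where "Tree j q \<in> ?W"
        using lm by blast
      from dist[OF this] show ?thesis
        using j branch by (simp add: lsg_dist_other_branch)
    qed
    show "u = v"
    proof (cases u)
      case (Cyc i)
      with branch height show ?thesis by (cases v) auto
    next
      case (Tree i p)
      with branch height obtain q where v_eq: "v = Tree i q" and len: "length p = length q"
        by (cases v) auto
      have p: "i < n" "set p \<subseteq> {..<m}" "length p + 2 \<le> k"
        using u Tree by (auto simp: lsg_verts_def)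
      have tree: "tree_dist p s = tree_dist q s" if "Tree i s \<in> ?W" for s
        using dist[OF that] Tree v_eq by simp
      show ?thesis
      proof (rule ccontr)
        assume "u \<noteq> v"
        then have "p \<noteq> q"
          using Tree v_eq by simp
        show False
        proof (cases "length p + 3 \<le> k")
          case True
          then obtain r where "Tree i (p @ r) \<in> ?W"
            using landmark_below p assms by metis
          from tree[OF this] have "tree_dist q p = 0"
            using tree_dist_extend_distinct[of q p "[]" r] tree_dist_append_same[of p "[]" r]
              \<open>p \<noteq> q\<close> len by simp
          with tree_dist_pos[of q p] \<open>p \<noteq> q\<close> show False by simp
        next
          case False
          then have leaf: "length p = k - 2"
            using p by simp
          \<comment> \<open>A landmark is the only vertex at distance 0 from itself.\<close>
          have "Tree i p \<notin> ?W" "Tree i q \<notin> ?W"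
            using tree[of p] tree[of q] tree_dist_pos[of p q] tree_dist_pos[of q p] \<open>p \<noteq> q\<close>
            by auto
          then obtain p' q'
            where p': "p = p' @ [0]" "(i, p') \<in> leaf_parents n m k" and q': "q = q' @ [0]"
            using nonlandmark_leaf[of i p n m k] nonlandmark_leaf[of i q n m k]
              u v Tree v_eq leaf len \<open>k \<ge> 3\<close> by metis
          have "Tree i (p' @ [1]) = leaf ((i, p'), 1)"
            by simp
          also have "\<dots> \<in> ?W"
            unfolding leaf_landmarks_def using p' assms by (intro imageI SigmaI) auto
          finally have "tree_dist p (p' @ [1]) = tree_dist q (p' @ [1])"
            by (rule tree)
          moreover have "q' \<noteq> p'" "length q' = length p'"
            using \<open>p \<noteq> q\<close> len p' q' by auto
          ultimately have "tree_dist q' p' = 0"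
            using tree_dist_extend_distinct[of q' p' "[0]" "[1]"] p'(1) q' by simp
          with tree_dist_pos[of q' p'] \<open>q' \<noteq> p'\<close> show False by simp
        qed
      qed
    qed
  qed
  then show "inj_on (\<lambda>v. \<lambda>w\<in>?W. gdist (LSG n m k) v w) (pverts (LSG n m k))"
    by (auto simp: LSG_def intro: inj_onI)
qed

section \<open>The metric dimension\<close>

theorem theorem3p1:
  fixes n m k :: nat
  assumes "n \<ge> 3" and "k \<ge> 3" and "m \<ge> 2"
  shows "metric_dimension (LSG n m k) = n * m ^ (k - 2) - n * m ^ (k - 3)"
proof -
  have pow: "n * m ^ (k - 2) = n * m ^ (k - 3) * m"
  proof -
    have "k - 2 = Suc (k - 3)"
      using \<open>k \<ge> 3\<close> by simp
    then show ?thesis by simp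
  qed
  have "finite (leaf_landmarks n m k)"
    by (simp add: leaf_landmarks_def finite_leaf_parents)
  then have "\<exists>W. finite W \<and> resolving_set (LSG n m k) W
      \<and> card W = n * m ^ (k - 2) - n * m ^ (k - 3)"
    using resolving_set_leaf_landmarks[OF assms]
    by (intro exI[of _ "leaf_landmarks n m k"])
      (simp add: card_leaf_landmarks pow diff_mult_distrib2)
  moreover have "n * m ^ (k - 2) - n * m ^ (k - 3) \<le> card W"
    if "finite W" "resolving_set (LSG n m k) W" for W
    using card_resolving_set_LSG that assms unfolding pow by blast
  ultimately show ?thesis
    unfolding metric_dimension_def by (intro Least_equality) auto
qed

end
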